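(* Let $\Delta_1,\Delta_2,\ldots$ be an IID sequence of real random variables, distributed as $\Delta$, with mean zero and finite variance $\sigma^2$. For unlimited generation capacity and unlimited storage capacity ($G_{\max}=S_{\max}=\infty$), the minimum over admissible policies of the average cost $J_G(\pi,S_1)=\limsup_{n\to\infty}\mathbb{E}\big[\frac1n\sum_{i=1}^n G_i\big]$ is $$J_G(\pi^{(1)},S_1)=(1-\alpha)\,\mathbb{E}[\Delta^-],$$ where $\pi^{(1)}$ is the (optimal) policy described in the context.
   Context: Single-bus power system with storage in slotted time $i=1,2,\ldots$. Constants: charging efficiency $\alpha_c\in(0,1)$, discharging efficiency $\alpha_d\in(0,1)$, round-trip efficiency $\alpha=\alpha_c\alpha_d$. The sequence $\Delta_i$ (net renewable generation prediction error) is exogenous. Notation: $x^+=\max\{x,0\}$, $x^-=\max\{-x,0\}$. The initial stored power $S_1\in[0,\infty)$ is given. With $G_{\max}=S_{\max}=\infty$, an admissible policy $\pi$ chooses $(G_i,C_i,D_i)$ (fast-ramping generation, charging, discharging) as a measurable function of $(S_1,\Delta_1,\ldots,S_{i-1},\Delta_{i-1},S_i)$ and $\Delta_i$ such that for all $i$: $S_{i+1}=S_i+\alpha_cC_i-\frac1{\alpha_d}D_i$, $S_i\ge0$, $G_i,C_i,D_i\ge0$, and $0\le G_i-C_i+D_i+\Delta_i$. The policy $\pi^{(1)}$ in this case: if $\Delta_i\ge0$, $(G_i,C_i,D_i)=(0,\Delta_i,0)$; if $-\alpha_dS_i\le\Delta_i<0$, $(G_i,C_i,D_i)=(0,0,-\Delta_i)$;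 if $\Delta_i<-\alpha_dS_i$, $(G_i,C_i,D_i)=(-\Delta_i-\alpha_dS_i,0,\alpha_dS_i)$. *)

theory Defs
  imports "HOL-Probability.Probability"
begin

text \<open>
  Time slots are the positive naturals. In slot \<open>i\<close> a policy sees the pair
  \<open>((S\<^sub>1, \<dots>, S\<^sub>i), (\<Delta>\<^sub>1, \<dots>, \<Delta>\<^sub>i))\<close>, each component being a function that is extensional on
  \<open>{1..i}\<close>, and returns the triple \<open>(G\<^sub>i, C\<^sub>i, D\<^sub>i)\<close>.
\<close>

type_synonym policy = "nat \<Rightarrow> (nat \<Rightarrow> real) \<times> (nat \<Rightarrow> real) \<Rightarrow> real \<times> real \<times> real"

definition history_space :: "nat \<Rightarrow> ((nat \<Rightarrow> real) \<times> (nat \<Rightarrow> real)) measure" where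
  "history_space i = (\<Pi>\<^sub>M j\<in>{1..i}. borel) \<Otimes>\<^sub>M (\<Pi>\<^sub>M j\<in>{1..i}. borel)"

text \<open>
  \<open>levels \<alpha>c \<alpha>d \<pi> s1 d n\<close> is the tuple \<open>(S\<^sub>1, \<dots>, S\<^sub>n)\<close> of storage levels generated by \<open>\<pi>\<close> from the
  initial level \<open>s1\<close> along the error sequence \<open>d\<close>. The lemmas below give the usual
  recursion for the individual levels.
\<close>

primrec levels ::
  "real \<Rightarrow> real \<Rightarrow> policy \<Rightarrow> real \<Rightarrow> (nat \<Rightarrow> real) \<Rightarrow> nat \<Rightarrow> nat \<Rightarrow> real" where
  "levels \<alpha>c \<alpha>d \<pi> s1 d 0 = (\<lambda>_. undefined)"
| "levels \<alpha>c \<alpha>d \<pi> s1 d (Suc n) = (levels \<alpha>c \<alpha>d \<pi> s1 d n)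
     (Suc n := if n = 0 then s1 else
       (case \<pi> n (levels \<alpha>c \<alpha>d \<pi> s1 d n, restrict d {1..n}) of
         (G, C, D) \<Rightarrow> levels \<alpha>c \<alpha>d \<pi> s1 d n n + \<alpha>c * C - 1 / \<alpha>d * D))"

definition storage ::
  "real \<Rightarrow> real \<Rightarrow> policy \<Rightarrow> real \<Rightarrow> (nat \<Rightarrow> real) \<Rightarrow> nat \<Rightarrow> real" where
  "storage \<alpha>c \<alpha>d \<pi> s1 d i = levels \<alpha>c \<alpha>d \<pi> s1 d i i"

definition action ::
  "real \<Rightarrow> real \<Rightarrow> policy \<Rightarrow> real \<Rightarrow> (nat \<Rightarrow> real) \<Rightarrow> nat \<Rightarrow> real \<times> real \<times> real" where
  "action \<alpha>c \<alpha>d \<pi> s1 d i = \<pi> i (levels \<alpha>c \<alpha>d \<pi> s1 d i, restrict d {1..i})"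

definition generation ::
  "real \<Rightarrow> real \<Rightarrow> policy \<Rightarrow> real \<Rightarrow> (nat \<Rightarrow> real) \<Rightarrow> nat \<Rightarrow> real" where
  "generation \<alpha>c \<alpha>d \<pi> s1 d i = fst (action \<alpha>c \<alpha>d \<pi> s1 d i)"

lemma levels_eq_restrict_storage:
  "levels \<alpha>c \<alpha>d \<pi> s1 d n = restrict (storage \<alpha>c \<alpha>d \<pi> s1 d) {1..n}"
proof (induction n)
  case (Suc n)
  have "levels \<alpha>c \<alpha>d \<pi> s1 d (Suc n) j = restrict (storage \<alpha>c \<alpha>d \<pi> s1 d) {1..Suc n} j" for j
  proof (cases "j = Suc n")
    case True
    then show ?thesis by (simp add: storage_def)
  next
    case False
    then have "levels \<alpha>c \<alpha>d \<pi> s1 d (Suc n) j = levels \<alpha>c \<alpha>d \<pi> s1 d n j" by simp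
    with False show ?thesis by (simp add: Suc.IH restrict_def)
  qed
  then show ?case by blast
qed (simp add: restrict_def fun_eq_iff)

lemma action_eq:
  "action \<alpha>c \<alpha>d \<pi> s1 d i =
     \<pi> i (restrict (storage \<alpha>c \<alpha>d \<pi> s1 d) {1..i}, restrict d {1..i})"
  by (simp add: action_def levels_eq_restrict_storage)

lemma storage_1: "storage \<alpha>c \<alpha>d \<pi> s1 d 1 = s1"
  by (simp add: storage_def)

lemma storage_Suc:
  assumes "i \<ge> 1" and "action \<alpha>c \<alpha>d \<pi> s1 d i = (G, C, D)"
  shows "storage \<alpha>c \<alpha>d \<pi> s1 d (Suc i) = storage \<alpha>c \<alpha>d \<pi> s1 d i + \<alpha>c * C - 1 / \<alpha>d * D"
  using assms by (simp add: storage_def action_def)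

text \<open>
  Admissibility is relative to the given initial level and the error process \<open>\<Delta>\<close>: the constraints
  are imposed along every realisation of the process.
\<close>

definition admissible ::
  "'a measure \<Rightarrow> real \<Rightarrow> real \<Rightarrow> (nat \<Rightarrow> 'a \<Rightarrow> real) \<Rightarrow> real \<Rightarrow> policy \<Rightarrow> bool" where
  "admissible M \<alpha>c \<alpha>d \<Delta> s1 \<pi> \<longleftrightarrow>
     (\<forall>i\<ge>1. \<pi> i \<in> borel_measurable (history_space i)) \<and>
     (\<forall>\<omega>\<in>space M. \<forall>i\<ge>1.
        storage \<alpha>c \<alpha>d \<pi> s1 (\<lambda>j. \<Delta> j \<omega>) i \<ge> 0 \<and>
        (case action \<alpha>c \<alpha>d \<pi> s1 (\<lambda>j. \<Delta> j \<omega>) i of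
          (G, C, D) \<Rightarrow> G \<ge> 0 \<and> C \<ge> 0 \<and> D \<ge> 0 \<and> 0 \<le> G - C + D + \<Delta> i \<omega>))"

text \<open>
  Generation is nonnegative under an admissible policy but need not be integrable, so the
  expectation is taken in the extended nonnegative reals.
\<close>

definition average_cost ::
  "'a measure \<Rightarrow> real \<Rightarrow> real \<Rightarrow> (nat \<Rightarrow> 'a \<Rightarrow> real) \<Rightarrow> real \<Rightarrow> policy \<Rightarrow> ennreal" where
  "average_cost M \<alpha>c \<alpha>d \<Delta> s1 \<pi> =
     limsup (\<lambda>n. \<integral>\<^sup>+\<omega>. ennreal (1 / real n *
       (\<Sum>i=1..n. generation \<alpha>c \<alpha>d \<pi> s1 (\<lambda>j. \<Delta> j \<omega>) i)) \<partial>M)"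

definition policy1 :: "real \<Rightarrow> policy" where
  "policy1 \<alpha>d i = (\<lambda>(s, d).
     if d i \<ge> 0 then (0, d i, 0)
     else if - \<alpha>d * s i \<le> d i then (0, 0, - d i)
     else (- d i - \<alpha>d * s i, 0, \<alpha>d * s i))"

end

theory Submission
  imports Defs "HOL-Real_Asymp.Real_Asymp"
begin

text \<open>
  Let \<open>w x = \<alpha>c x\<^sup>+ - x\<^sup>- / \<alpha>d\<close> be the change of the storage level when every error is absorbed by
  the storage. The constraints force \<open>G\<^sub>i \<ge> \<alpha>d (S\<^sub>i\<^sub>+\<^sub>1 - S\<^sub>i - w \<Delta>\<^sub>i)\<close> for every admissible
  policy, with equality for \<open>\<pi>\<^sup>(\<^sup>1\<^sup>)\<close>. Summing telescopes, and \<open>-\<alpha>d E[w \<Delta>] = (1 - \<alpha>) E[\<Delta>\<^sup>-]\<close> because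
  \<open>E[\<Delta>\<^sup>+] = E[\<Delta>\<^sup>-]\<close>; dropping \<open>S\<^sub>n\<^sub>+\<^sub>1 \<ge> 0\<close> gives the lower bound. Under \<open>\<pi>\<^sup>(\<^sup>1\<^sup>)\<close> the level is the random walk
  with steps \<open>w \<Delta>\<^sub>i\<close> reflected at \<open>0\<close>. Since the steps have nonpositive mean, its second moment
  grows at most linearly, so \<open>E[S\<^sub>n] / n \<rightarrow> 0\<close> and the bound is attained.
\<close>

section \<open>Pathwise lower bound on generation\<close>

definition absorb :: "real \<Rightarrow> real \<Rightarrow> real \<Rightarrow> real" where
  "absorb \<alpha>c \<alpha>d x = \<alpha>c * max x 0 - max (- x) 0 / \<alpha>d"

lemma absorb_measurable [measurable]: "absorb \<alpha>c \<alpha>d \<in> borel_measurable borel"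
  unfolding absorb_def by measurable

text \<open>The balance constraint reads \<open>C - x \<le> G + D\<close>. For
  \<open>x \<ge> 0\<close>, scale it by the round-trip efficiency and use that this factor is at
  most 1 on \<open>G + D\<close>; for \<open>x < 0\<close>, use instead that the factor is at most 1
  on \<open>C\<close>.\<close>

lemma generation_lower_bound_step:
  fixes \<alpha>c \<alpha>d G C D x :: real
  assumes "0 < \<alpha>c" "\<alpha>c < 1" "0 < \<alpha>d" "\<alpha>d < 1"
    and "G \<ge> 0" "C \<ge> 0" "D \<ge> 0" "0 \<le> G - C + D + x"
  shows "\<alpha>d * (\<alpha>c * C - 1 / \<alpha>d * D - absorb \<alpha>c \<alpha>d x) \<le> G"
proof -
  \<comment> \<open>The round-trip efficiency; both cases rest on its lying between 0 and 1.\<close>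
  define a where "a = \<alpha>c * \<alpha>d"
  have a: "0 \<le> a" "a \<le> 1"
    using assms mult_le_one[of \<alpha>c \<alpha>d] by (auto simp: a_def)
  have eq: "\<alpha>d * (\<alpha>c * C - 1 / \<alpha>d * D - absorb \<alpha>c \<alpha>d x) =
      a * (C - max x 0) - D + max (- x) 0"
    using assms by (simp add: absorb_def a_def field_simps)
  show ?thesis
  proof (cases "x \<ge> 0")
    case True
    have "a * (C - x) \<le> a * (G + D)"
      using assms a by (intro mult_left_mono) auto
    also have "\<dots> \<le> G + D"
      using assms a by (intro mult_left_le_one_le) auto
    finally show ?thesis using True unfolding eq by simp
  next
    case False
    have "a * C \<le> C"
      using assms a by (intro mult_left_le_one_le) auto
    then show ?thesis using False assms unfolding eq by simp
  qed
qed

lemma admissible_storage_nonneg: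
  "admissible M \<alpha>c \<alpha>d \<Delta> s1 \<pi> \<Longrightarrow> \<omega> \<in> space M \<Longrightarrow> i \<ge> 1
    \<Longrightarrow> 0 \<le> storage \<alpha>c \<alpha>d \<pi> s1 (\<lambda>j. \<Delta> j \<omega>) i"
  by (simp add: admissible_def)

lemma admissible_action:
  assumes "admissible M \<alpha>c \<alpha>d \<Delta> s1 \<pi>" "\<omega> \<in> space M" "i \<ge> 1"
    and "action \<alpha>c \<alpha>d \<pi> s1 (\<lambda>j. \<Delta> j \<omega>) i = (G, C, D)"
  shows "0 \<le> G" "0 \<le> C" "0 \<le> D" "0 \<le> G - C + D + \<Delta> i \<omega>"
proof -
  have "case action \<alpha>c \<alpha>d \<pi> s1 (\<lambda>j. \<Delta> j \<omega>) i of
      (G, C, D) \<Rightarrow> G \<ge> 0 \<and> C \<ge> 0 \<and> D \<ge> 0 \<and> 0 \<le> G - C + D + \<Delta> i \<omega>"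
    using assms(1-3) by (simp add: admissible_def)
  then show "0 \<le> G" "0 \<le> C" "0 \<le> D" "0 \<le> G - C + D + \<Delta> i \<omega>"
    by (simp_all add: assms(4))
qed

lemma admissible_generation_nonneg:
  assumes "admissible M \<alpha>c \<alpha>d \<Delta> s1 \<pi>" "\<omega> \<in> space M" "i \<ge> 1"
  shows "0 \<le> generation \<alpha>c \<alpha>d \<pi> s1 (\<lambda>j. \<Delta> j \<omega>) i"
proof -
  obtain G C D where "action \<alpha>c \<alpha>d \<pi> s1 (\<lambda>j. \<Delta> j \<omega>) i = (G, C, D)"
    by (rule prod_cases3)
  then show ?thesis
    using admissible_action(1)[OF assms] by (simp add: generation_def)
qed

text \<open>The storage increments telescope. The bound holds for every realisation, so expectations
  enter only afterwards, and the leftover \<open>s1\<close> disappears after division by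
  \<open>n\<close>.\<close>

lemma generation_sum_lower_bound:
  assumes "0 < \<alpha>c" "\<alpha>c < 1" "0 < \<alpha>d" "\<alpha>d < 1"
    and adm: "admissible M \<alpha>c \<alpha>d \<Delta> s1 \<pi>" and \<omega>: "\<omega> \<in> space M"
  shows "\<alpha>d * (- s1 - (\<Sum>i=1..n. absorb \<alpha>c \<alpha>d (\<Delta> i \<omega>)))
    \<le> (\<Sum>i=1..n. generation \<alpha>c \<alpha>d \<pi> s1 (\<lambda>j. \<Delta> j \<omega>) i)"
proof -
  define d where "d = (\<lambda>j. \<Delta> j \<omega>)"
  define S where "S = storage \<alpha>c \<alpha>d \<pi> s1 d"
  have step: "\<alpha>d * (S (Suc i) - S i - absorb \<alpha>c \<alpha>d (d i)) \<le> generation \<alpha>c \<alpha>d \<pi> s1 d i"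
    if "i \<ge> 1" for i
  proof -
    obtain G C D where act: "action \<alpha>c \<alpha>d \<pi> s1 d i = (G, C, D)"
      by (rule prod_cases3)
    have "\<alpha>d * (\<alpha>c * C - 1 / \<alpha>d * D - absorb \<alpha>c \<alpha>d (\<Delta> i \<omega>)) \<le> G"
      by (rule generation_lower_bound_step[OF assms(1-4)
            admissible_action[OF adm \<omega> that act[unfolded d_def]]])
    then show ?thesis
      using storage_Suc[OF that act] act by (simp add: S_def d_def generation_def)
  qed
  have "\<alpha>d * (S (Suc n) - s1 - (\<Sum>i=1..n. absorb \<alpha>c \<alpha>d (d i)))
      \<le> (\<Sum>i=1..n. generation \<alpha>c \<alpha>d \<pi> s1 d i)"
  proof (induction n)
    case 0
    then show ?case using storage_1 by (simp add: S_def)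
  next
    case (Suc n)
    then show ?case using step[of "Suc n"] by (simp add: algebra_simps)
  qed
  moreover have "0 \<le> S (Suc n)"
    using admissible_storage_nonneg[OF adm \<omega>] by (simp add: S_def d_def)
  then have "\<alpha>d * (- s1 - (\<Sum>i=1..n. absorb \<alpha>c \<alpha>d (d i)))
      \<le> \<alpha>d * (S (Suc n) - s1 - (\<Sum>i=1..n. absorb \<alpha>c \<alpha>d (d i)))"
    using \<open>0 < \<alpha>d\<close> by (intro mult_left_mono) auto
  ultimately show ?thesis by (simp add: d_def)
qed

section \<open>Storage under \<open>policy1\<close> as a walk reflected at 0\<close>

text \<open>This is the Lindley recursion of queueing theory. The value at \<open>n\<close> has used
  the steps \<open>w 1\<close> to \<open>w n\<close>.\<close>

primrec reflected_walk :: "real \<Rightarrow> (nat \<Rightarrow> real) \<Rightarrow> nat \<Rightarrow> real" where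
  "reflected_walk s w 0 = s"
| "reflected_walk s w (Suc n) = max 0 (reflected_walk s w n + w (Suc n))"

lemma reflected_walk_nonneg: "0 \<le> s \<Longrightarrow> 0 \<le> reflected_walk s w n"
  by (cases n) auto

text \<open>Lets the walk at time \<open>n\<close> be read as a function on the product space of the
  first \<open>n\<close> coordinates, as the independence argument requires.\<close>

lemma reflected_walk_restrict:
  "n \<le> m \<Longrightarrow> reflected_walk s (restrict w {1..m}) n = reflected_walk s w n"
  by (induction n) auto

text \<open>The source space is arbitrary, so that the lemma serves both for random steps on a
  probability space and for the coordinate maps of a product space.\<close>

lemma reflected_walk_measurable:
  assumes "\<And>i. i \<in> {1..n} \<Longrightarrow> (\<lambda>\<omega>. W \<omega> i) \<in> borel_measurable M"
  shows "(\<lambda>\<omega>. reflected_walk s (W \<omega>) n) \<in> borel_measurable M"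
  using assms
proof (induction n)
  case (Suc n)
  have [measurable]: "(\<lambda>\<omega>. reflected_walk s (W \<omega>) n) \<in> borel_measurable M"
    "(\<lambda>\<omega>. W \<omega> (Suc n)) \<in> borel_measurable M"
    using Suc by auto
  show ?case by simp
qed simp

text \<open>The policy stores every surplus and serves a deficit from the store until it is empty,
  which is reflection at 0. The index is shifted because levels are numbered from 1 and the walk
  from 0.\<close>

lemma storage_policy1:
  assumes "0 < \<alpha>c" "0 < \<alpha>d" "0 \<le> s1"
  shows "storage \<alpha>c \<alpha>d (policy1 \<alpha>d) s1 d (Suc n)
    = reflected_walk s1 (\<lambda>i. absorb \<alpha>c \<alpha>d (d i)) n"
proof (induction n)
  case 0
  then show ?case using storage_1 by simp
next
  case (Suc n)
  define S where "S = storage \<alpha>c \<alpha>d (policy1 \<alpha>d) s1 d (Suc n)"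
  have "0 \<le> S"
    using assms(3) by (simp add: S_def Suc reflected_walk_nonneg)
  have act: "action \<alpha>c \<alpha>d (policy1 \<alpha>d) s1 d (Suc n) =
      (if d (Suc n) \<ge> 0 then (0, d (Suc n), 0)
       else if - \<alpha>d * S \<le> d (Suc n) then (0, 0, - d (Suc n))
       else (- d (Suc n) - \<alpha>d * S, 0, \<alpha>d * S))"
    by (simp add: action_eq policy1_def S_def)
  have "storage \<alpha>c \<alpha>d (policy1 \<alpha>d) s1 d (Suc (Suc n)) = max 0 (S + absorb \<alpha>c \<alpha>d (d (Suc n)))"
  proof -
    consider "d (Suc n) \<ge> 0" | "d (Suc n) < 0" "- \<alpha>d * S \<le> d (Suc n)"
      | "d (Suc n) < 0" "d (Suc n) < - \<alpha>d * S" by linarith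
    then show ?thesis
    proof cases
      case 1
      then show ?thesis
        using storage_Suc[of "Suc n" \<alpha>c \<alpha>d "policy1 \<alpha>d" s1 d] act \<open>0 \<le> S\<close> assms
        by (simp add: absorb_def S_def)
    next
      case 2
      then show ?thesis
        using storage_Suc[of "Suc n" \<alpha>c \<alpha>d "policy1 \<alpha>d" s1 d] act \<open>0 \<le> S\<close> assms
        by (simp add: absorb_def field_simps flip: S_def)
    next
      case 3
      then have "action \<alpha>c \<alpha>d (policy1 \<alpha>d) s1 d (Suc n) = (- d (Suc n) - \<alpha>d * S, 0, \<alpha>d * S)"
        using act by simp
      \<comment> \<open>Delivering \<open>\<alpha>d * S\<close> drains exactly \<open>S\<close> from
        the store. The walk is at 0 too, since the uncovered deficit makes
        \<open>S + absorb \<alpha>c \<alpha>d (d (Suc n))\<close> negative.\<close>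
      from storage_Suc[OF _ this] have "storage \<alpha>c \<alpha>d (policy1 \<alpha>d) s1 d (Suc (Suc n)) = 0"
        using assms by (simp add: S_def)
      with 3 show ?thesis
        using assms by (simp add: absorb_def max_def field_simps)
    qed
  qed
  then show ?case by (simp add: S_def Suc)
qed

lemma storage_policy1_nonneg:
  assumes "0 < \<alpha>c" "0 < \<alpha>d" "0 \<le> s1" "i \<ge> 1"
  shows "0 \<le> storage \<alpha>c \<alpha>d (policy1 \<alpha>d) s1 d i"
  using storage_policy1[OF assms(1-3), of d "i - 1"] assms(3,4)
  by (simp add: reflected_walk_nonneg)

text \<open>Generation occurs only when the deficit exceeds what the store can deliver, and then
  equals \<open>\<alpha>d\<close> times the push that keeps the walk at 0. Hence each slot attains
  the lower bound with equality, and the sum telescopes.\<close>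

lemma generation_policy1_sum:
  assumes "0 < \<alpha>c" "0 < \<alpha>d" "0 \<le> s1"
  shows "(\<Sum>i=1..n. generation \<alpha>c \<alpha>d (policy1 \<alpha>d) s1 d i) =
    \<alpha>d * (reflected_walk s1 (\<lambda>i. absorb \<alpha>c \<alpha>d (d i)) n - s1
      - (\<Sum>i=1..n. absorb \<alpha>c \<alpha>d (d i)))"
proof (induction n)
  case (Suc n)
  define S where "S = reflected_walk s1 (\<lambda>i. absorb \<alpha>c \<alpha>d (d i)) n"
  define x where "x = d (Suc n)"
  have "0 \<le> S"
    using assms by (simp add: S_def reflected_walk_nonneg)
  have "generation \<alpha>c \<alpha>d (policy1 \<alpha>d) s1 d (Suc n) =
      (if x \<ge> 0 then 0 else if - \<alpha>d * S \<le> x then 0 else - x - \<alpha>d * S)"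
    by (simp add: generation_def action_eq policy1_def storage_policy1[OF assms] S_def x_def)
  also have "\<dots> = \<alpha>d * (max 0 (S + absorb \<alpha>c \<alpha>d x) - S - absorb \<alpha>c \<alpha>d x)"
  proof (cases "0 \<le> x")
    case True
    then have "0 \<le> S + \<alpha>c * x"
      using \<open>0 \<le> S\<close> assms by simp
    then show ?thesis using True by (simp add: absorb_def)
  next
    case False
    then show ?thesis
      using assms by (auto simp: absorb_def max_def field_simps)
  qed
  finally show ?case
    using Suc by (simp add: S_def x_def algebra_simps)
qed simp

section \<open>Measurability and admissibility of \<open>policy1\<close>\<close>

lemma policy1_measurable:
  assumes "i \<ge> 1"
  shows "policy1 \<alpha>d i \<in> borel_measurable (history_space i)"
proof -
  have [measurable]: "(\<lambda>h. fst h i) \<in> borel_measurable (history_space i)"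
    "(\<lambda>h. snd h i) \<in> borel_measurable (history_space i)"
    unfolding history_space_def using assms
    by (auto intro!: measurable_compose[OF measurable_fst] measurable_compose[OF measurable_snd])
  have "policy1 \<alpha>d i = (\<lambda>h. if snd h i \<ge> 0 then (0, snd h i, 0)
     else if - \<alpha>d * fst h i \<le> snd h i then (0, 0, - snd h i)
     else (- snd h i - \<alpha>d * fst h i, 0, \<alpha>d * fst h i))"
    by (auto simp: policy1_def fun_eq_iff)
  then show ?thesis
    \<comment> \<open>Writing the Borel algebra on triples as a product of Borel algebras reduces
      the claim to the components.\<close>
    by (simp flip: borel_prod)
qed

text \<open>A pathwise check: all three branches meet the power balance with equality, and
  nonnegativity of the level gives \<open>D \<ge> 0\<close> in the branch that empties the
  store.\<close>

lemma policy1_admissible: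
  assumes "0 < \<alpha>c" "0 < \<alpha>d" "0 \<le> s1"
  shows "admissible M \<alpha>c \<alpha>d \<Delta> s1 (policy1 \<alpha>d)"
  unfolding admissible_def
proof (intro conjI allI impI ballI)
  fix i :: nat and \<omega>
  assume "i \<ge> 1"
  then show "policy1 \<alpha>d i \<in> borel_measurable (history_space i)"
    by (rule policy1_measurable)
  show "0 \<le> storage \<alpha>c \<alpha>d (policy1 \<alpha>d) s1 (\<lambda>j. \<Delta> j \<omega>) i"
    using assms \<open>i \<ge> 1\<close> by (rule storage_policy1_nonneg)
  then show "case action \<alpha>c \<alpha>d (policy1 \<alpha>d) s1 (\<lambda>j. \<Delta> j \<omega>) i of
      (G, C, D) \<Rightarrow> 0 \<le> G \<and> 0 \<le> C \<and> 0 \<le> D \<and> 0 \<le> G - C + D + \<Delta> i \<omega>"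
    using \<open>0 < \<alpha>d\<close> \<open>i \<ge> 1\<close> by (auto simp: action_eq policy1_def)
qed

section \<open>Moments of a reflected walk with independent steps\<close>

context prob_space
begin

text \<open>The two variables are functions of the disjoint index blocks \<open>{1..n}\<close> and
  \<open>{Suc n}\<close>.\<close>

lemma indep_var_reflected_walk:
  assumes "indep_vars (\<lambda>_. borel) W {1..}"
  shows "indep_var borel (\<lambda>\<omega>. reflected_walk s (\<lambda>i. W i \<omega>) n) borel (W (Suc n))"
proof -
  let ?f = "\<lambda>w. reflected_walk s w n"
  have "indep_var borel (?f \<circ> (\<lambda>\<omega>. restrict (\<lambda>i. W i \<omega>) {1..n}))
      borel ((\<lambda>w. w (Suc n)) \<circ> (\<lambda>\<omega>. restrict (\<lambda>i. W i \<omega>) {Suc n}))"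
  proof (rule indep_var_compose)
    show "indep_var (\<Pi>\<^sub>M i\<in>{1..n}. borel) (\<lambda>\<omega>. restrict (\<lambda>i. W i \<omega>) {1..n})
        (\<Pi>\<^sub>M i\<in>{Suc n}. borel) (\<lambda>\<omega>. restrict (\<lambda>i. W i \<omega>) {Suc n})"
      by (rule indep_var_restrict[OF assms]) auto
    show "?f \<in> borel_measurable (\<Pi>\<^sub>M i\<in>{1..n}. borel)"
      by (intro reflected_walk_measurable) simp
  qed simp
  then show ?thesis by (simp add: comp_def reflected_walk_restrict del: One_nat_def)
qed

text \<open>Reflection does not increase the square, since \<open>max 0 y\<close> is 0 or
  \<open>y\<close>. After expanding, independence factors the cross term into a nonnegative mean
  times a nonpositive drift, so each step adds at most \<open>K\<close>.\<close>

lemma reflected_walk_second_moment: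
  assumes indep: "indep_vars (\<lambda>_. borel) W {1..}"
    and sq: "\<And>i. i \<ge> 1 \<Longrightarrow> integrable M (\<lambda>\<omega>. (W i \<omega>)\<^sup>2)"
    and drift: "\<And>i. i \<ge> 1 \<Longrightarrow> expectation (W i) \<le> 0"
    and K: "\<And>i. i \<ge> 1 \<Longrightarrow> expectation (\<lambda>\<omega>. (W i \<omega>)\<^sup>2) \<le> K"
    and "0 \<le> s"
  shows "integrable M (\<lambda>\<omega>. (reflected_walk s (\<lambda>i. W i \<omega>) n)\<^sup>2)"
    and "expectation (\<lambda>\<omega>. (reflected_walk s (\<lambda>i. W i \<omega>) n)\<^sup>2) \<le> s\<^sup>2 + n * K"
proof -
  have rv: "W i \<in> borel_measurable M" if "i \<ge> 1" for i
    using indep that unfolding indep_vars_def2 by auto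
  have int: "integrable M (W i)" if "i \<ge> 1" for i
    using square_integrable_imp_integrable rv sq that by blast
  define S where "S = (\<lambda>n \<omega>. reflected_walk s (\<lambda>i. W i \<omega>) n)"
  have S_rv [measurable]: "S n \<in> borel_measurable M" for n
    unfolding S_def by (intro reflected_walk_measurable rv) auto
  have S_nonneg: "0 \<le> S n \<omega>" for n \<omega>
    using \<open>0 \<le> s\<close> by (simp add: S_def reflected_walk_nonneg)
  have "integrable M (\<lambda>\<omega>. (S n \<omega>)\<^sup>2) \<and> expectation (\<lambda>\<omega>. (S n \<omega>)\<^sup>2) \<le> s\<^sup>2 + n * K" for n
  proof (induction n)
    case 0
    then show ?case by (simp add: S_def prob_space)
  next
    case (Suc n)
    define V where "V = W (Suc n)"
    have V: "integrable M (\<lambda>\<omega>. (V \<omega>)\<^sup>2)" "integrable M V" "expectation V \<le> 0"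
      "expectation (\<lambda>\<omega>. (V \<omega>)\<^sup>2) \<le> K"
      using sq int drift K by (auto simp: V_def)
    have S: "integrable M (\<lambda>\<omega>. (S n \<omega>)\<^sup>2)" "integrable M (S n)"
      using Suc square_integrable_imp_integrable[OF S_rv] by auto
    have ind: "indep_var borel (S n) borel V"
      using indep_var_reflected_walk[OF indep] by (simp add: S_def V_def)
    note SV = indep_var_integrable[OF ind S(2) V(2)]
    have "expectation (S n) * expectation V \<le> 0"
      using V(3) S_nonneg by (intro mult_nonneg_nonpos) auto
    then have cross: "expectation (\<lambda>\<omega>. S n \<omega> * V \<omega>) \<le> 0"
      using indep_var_lebesgue_integral[OF ind S(2) V(2)] by simp
    have le: "(S (Suc n) \<omega>)\<^sup>2 \<le> (S n \<omega>)\<^sup>2 + 2 * (S n \<omega> * V \<omega>) + (V \<omega>)\<^sup>2" for \<omega>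
    proof -
      have "(S (Suc n) \<omega>)\<^sup>2 \<le> (S n \<omega> + V \<omega>)\<^sup>2"
        by (simp add: S_def V_def max_def)
      then show ?thesis by (simp add: power2_eq_square algebra_simps)
    qed
    have bound: "integrable M (\<lambda>\<omega>. (S n \<omega>)\<^sup>2 + 2 * (S n \<omega> * V \<omega>) + (V \<omega>)\<^sup>2)"
      using S V SV by auto
    have sqint: "integrable M (\<lambda>\<omega>. (S (Suc n) \<omega>)\<^sup>2)"
      by (rule Bochner_Integration.integrable_bound[OF bound])
        (use le in \<open>auto intro: order_trans[OF _ abs_ge_self]\<close>)
    have "expectation (\<lambda>\<omega>. (S (Suc n) \<omega>)\<^sup>2)
        \<le> expectation (\<lambda>\<omega>. (S n \<omega>)\<^sup>2 + 2 * (S n \<omega> * V \<omega>) + (V \<omega>)\<^sup>2)"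
      using le by (intro integral_mono sqint bound)
    also have "\<dots> = expectation (\<lambda>\<omega>. (S n \<omega>)\<^sup>2) + 2 * expectation (\<lambda>\<omega>. S n \<omega> * V \<omega>)
        + expectation (\<lambda>\<omega>. (V \<omega>)\<^sup>2)"
      using S V SV by simp
    also have "\<dots> \<le> s\<^sup>2 + Suc n * K"
      using Suc cross V(4) by (simp add: algebra_simps)
    finally show ?case using sqint by simp
  qed
  then show "integrable M (\<lambda>\<omega>. (reflected_walk s (\<lambda>i. W i \<omega>) n)\<^sup>2)"
    "expectation (\<lambda>\<omega>. (reflected_walk s (\<lambda>i. W i \<omega>) n)\<^sup>2) \<le> s\<^sup>2 + n * K"
    by (auto simp: S_def)
qed

text \<open>Nonnegativity of the variance turns linear growth of the second moment into growth of
  the mean of order at most the square root of \<open>n\<close>.\<close>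

lemma reflected_walk_mean_sublinear:
  assumes indep: "indep_vars (\<lambda>_. borel) W {1..}"
    and sq: "\<And>i. i \<ge> 1 \<Longrightarrow> integrable M (\<lambda>\<omega>. (W i \<omega>)\<^sup>2)"
    and drift: "\<And>i. i \<ge> 1 \<Longrightarrow> expectation (W i) \<le> 0"
    and K: "\<And>i. i \<ge> 1 \<Longrightarrow> expectation (\<lambda>\<omega>. (W i \<omega>)\<^sup>2) \<le> K"
    and "0 \<le> s"
  shows "integrable M (\<lambda>\<omega>. reflected_walk s (\<lambda>i. W i \<omega>) n)"
    and "(\<lambda>n. expectation (\<lambda>\<omega>. reflected_walk s (\<lambda>i. W i \<omega>) n) / n) \<longlonglongrightarrow> 0"
proof -
  define S where "S = (\<lambda>n \<omega>. reflected_walk s (\<lambda>i. W i \<omega>) n)"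
  have S_rv: "S n \<in> borel_measurable M" for n
    unfolding S_def using indep
    by (intro reflected_walk_measurable) (auto simp: indep_vars_def2)
  have S_sq: "integrable M (\<lambda>\<omega>. (S n \<omega>)\<^sup>2)" "expectation (\<lambda>\<omega>. (S n \<omega>)\<^sup>2) \<le> s\<^sup>2 + n * K" for n
    using reflected_walk_second_moment[OF assms] by (auto simp: S_def)
  have S_int: "integrable M (S n)" for n
    using square_integrable_imp_integrable[OF S_rv S_sq(1)] .
  then show "integrable M (\<lambda>\<omega>. reflected_walk s (\<lambda>i. W i \<omega>) n)"
    by (simp add: S_def)
  have nonneg: "0 \<le> expectation (S n)" for n
    using \<open>0 \<le> s\<close> by (simp add: S_def reflected_walk_nonneg)
  have le: "expectation (S n) \<le> sqrt (s\<^sup>2 + n * K)" for n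
  proof (rule real_le_rsqrt)
    show "(expectation (S n))\<^sup>2 \<le> s\<^sup>2 + n * K"
      using variance_eq[OF S_int S_sq(1)] variance_positive[of "S n"] S_sq(2)[of n]
      by fastforce
  qed
  have "(\<lambda>n. expectation (S n) / n) \<longlonglongrightarrow> 0"
  proof (rule tendsto_sandwich)
    show "\<forall>\<^sub>F n in sequentially. 0 \<le> expectation (S n) / n"
      by (simp add: nonneg)
    show "\<forall>\<^sub>F n in sequentially. expectation (S n) / n \<le> sqrt (s\<^sup>2 / (real n)\<^sup>2 + K / real n)"
      using eventually_gt_at_top[of 0]
    proof eventually_elim
      case (elim n)
      then have "s\<^sup>2 / n^2 + K / n = (s\<^sup>2 + n * K) / n^2"
        by (simp add: field_simps power2_eq_square)
      then have "sqrt (s\<^sup>2 / (real n)\<^sup>2 + K / real n) = sqrt (s\<^sup>2 + n * K) / n"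
        by (simp add: real_sqrt_divide)
      then show ?case using le[of n] by (simp add: divide_right_mono)
    qed
    show "(\<lambda>n. sqrt (s\<^sup>2 / (real n)\<^sup>2 + K / real n)) \<longlonglongrightarrow> 0"
    proof -
      have "(\<lambda>n. s\<^sup>2 / real n^2 + K / real n) \<longlonglongrightarrow> 0" by real_asymp
      then show ?thesis using tendsto_real_sqrt by fastforce
    qed
  qed simp
  then show "(\<lambda>n. expectation (\<lambda>\<omega>. reflected_walk s (\<lambda>i. W i \<omega>) n) / n) \<longlonglongrightarrow> 0"
    by (simp add: S_def)
qed

end

section \<open>Optimality of \<open>policy1\<close> and the value of the minimum cost\<close>

theorem proposition1:
  fixes M :: "'a measure" and \<Delta> :: "nat \<Rightarrow> 'a \<Rightarrow> real" and X :: "'a \<Rightarrow> real"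
    and \<alpha>c \<alpha>d \<alpha> \<sigma> s1 :: real
  assumes "prob_space M"
    and "0 < \<alpha>c" "\<alpha>c < 1" "0 < \<alpha>d" "\<alpha>d < 1" "\<alpha> = \<alpha>c * \<alpha>d"
    and "s1 \<ge> 0"
    and "prob_space.indep_vars M (\<lambda>_. borel) \<Delta> {1..}"
    and "X \<in> borel_measurable M"
    and "\<And>i. i \<ge> 1 \<Longrightarrow> distr M borel (\<Delta> i) = distr M borel X"
    and "integrable M X" "prob_space.expectation M X = 0"
    and "integrable M (\<lambda>\<omega>. (X \<omega>)\<^sup>2)" "prob_space.variance M X = \<sigma>\<^sup>2"
  shows "is_arg_min (average_cost M \<alpha>c \<alpha>d \<Delta> s1) (admissible M \<alpha>c \<alpha>d \<Delta> s1) (policy1 \<alpha>d)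
    \<and> average_cost M \<alpha>c \<alpha>d \<Delta> s1 (policy1 \<alpha>d) =
        ennreal ((1 - \<alpha>) * prob_space.expectation M (\<lambda>\<omega>. max (- X \<omega>) 0))"
proof -
  interpret prob_space M by fact
  note par = assms(2-5) and s1 = assms(7) and indep = assms(8)
  have X [measurable]: "X \<in> borel_measurable M" by fact
  define w where "w = absorb \<alpha>c \<alpha>d"
  define m where "m = expectation (\<lambda>\<omega>. max (- X \<omega>) 0)"
  define W where "W = (\<lambda>i \<omega>. w (\<Delta> i \<omega>))"
  have w [measurable]: "w \<in> borel_measurable borel"
    by (simp add: w_def)
  have \<Delta>_rv: "\<Delta> i \<in> borel_measurable M" if "i \<ge> 1" for i
    using indep that unfolding indep_vars_def2 by auto
  \<comment> \<open>Equality in law lets every moment below be computed once, for the generic error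
    \<open>X\<close>.\<close>
  have transfer_int: "integrable M (\<lambda>\<omega>. f (\<Delta> i \<omega>)) \<longleftrightarrow> integrable M (\<lambda>\<omega>. f (X \<omega>))"
    and transfer_exp: "expectation (\<lambda>\<omega>. f (\<Delta> i \<omega>)) = expectation (\<lambda>\<omega>. f (X \<omega>))"
    if "i \<ge> 1" "f \<in> borel_measurable borel" for i and f :: "real \<Rightarrow> real"
    using assms(10)[OF that(1)] integrable_distr_eq[OF \<Delta>_rv[OF that(1)] that(2)]
      integrable_distr_eq[OF X that(2)] integral_distr[OF \<Delta>_rv[OF that(1)] that(2)]
      integral_distr[OF X that(2)] by simp_all
  have pos_int: "integrable M (\<lambda>\<omega>. max (X \<omega>) 0)" "integrable M (\<lambda>\<omega>. max (- X \<omega>) 0)"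
    using assms(11) by auto
  have "expectation (\<lambda>\<omega>. max (X \<omega>) 0 - max (- X \<omega>) 0) = expectation X"
    by (rule Bochner_Integration.integral_cong) auto
  then have "expectation (\<lambda>\<omega>. max (X \<omega>) 0) = m"
    using pos_int assms(12) by (simp add: m_def)
  then have wX: "integrable M (\<lambda>\<omega>. w (X \<omega>))" "expectation (\<lambda>\<omega>. w (X \<omega>)) = \<alpha>c * m - m / \<alpha>d"
    using pos_int by (simp_all add: w_def absorb_def m_def)
  have drift: "\<alpha>d * (\<alpha>c * m - m / \<alpha>d) = - ((1 - \<alpha>) * m)"
    using par assms(6) by (simp add: field_simps)
  have m: "0 \<le> m" by (simp add: m_def)
  have \<alpha>: "\<alpha> \<le> 1" using par assms(6) mult_le_one[of \<alpha>c \<alpha>d] by simp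
  \<comment> \<open>Conversion losses make the mean step nonpositive, which is the drift condition
    of the second moment bound.\<close>
  have "\<alpha>d * (\<alpha>c * m - m / \<alpha>d) \<le> 0"
    unfolding drift using m \<alpha> by simp
  then have drift_nonpos: "\<alpha>c * m - m / \<alpha>d \<le> 0"
    using par by (simp add: mult_le_0_iff)
  have wX_sq: "integrable M (\<lambda>\<omega>. (w (X \<omega>))\<^sup>2)"
  proof (rule Bochner_Integration.integrable_bound)
    show "integrable M (\<lambda>\<omega>. (\<alpha>c\<^sup>2 + 1 / \<alpha>d\<^sup>2) * (X \<omega>)\<^sup>2)"
      using assms(13) by simp
    \<comment> \<open>At most one of the two parts of \<open>x\<close> is nonzero, so the left side
      is one of the two summands on the right.\<close>
    have "(w x)\<^sup>2 \<le> (\<alpha>c\<^sup>2 + 1 / \<alpha>d\<^sup>2) * x\<^sup>2" for x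
      by (auto simp: w_def absorb_def max_def power_mult_distrib power_divide algebra_simps)
    then show "AE \<omega> in M. norm ((w (X \<omega>))\<^sup>2) \<le> norm ((\<alpha>c\<^sup>2 + 1 / \<alpha>d\<^sup>2) * (X \<omega>)\<^sup>2)"
      by (auto intro: order_trans[OF _ abs_ge_self])
  qed measurable
  have W_int: "integrable M (W i)" and W_exp: "expectation (W i) = \<alpha>c * m - m / \<alpha>d"
    and W_sq: "integrable M (\<lambda>\<omega>. (W i \<omega>)\<^sup>2)"
    and W_sq_exp: "expectation (\<lambda>\<omega>. (W i \<omega>)\<^sup>2) = expectation (\<lambda>\<omega>. (w (X \<omega>))\<^sup>2)"
    if "i \<ge> 1" for i
    using wX wX_sq transfer_int[OF that, of w] transfer_exp[OF that, of w]
      transfer_int[OF that, of "\<lambda>x. (w x)\<^sup>2"] transfer_exp[OF that, of "\<lambda>x. (w x)\<^sup>2"]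
    by (simp_all add: W_def)
  define S where "S = (\<lambda>n \<omega>. reflected_walk s1 (\<lambda>i. W i \<omega>) n)"
  have W_indep: "indep_vars (\<lambda>_. borel) W {1..}"
    unfolding W_def by (rule indep_vars_compose2[OF indep]) simp
  \<comment> \<open>The common second moment of the steps serves as the constant
    \<open>K\<close>.\<close>
  have S: "integrable M (S n)" "(\<lambda>n. expectation (S n) / n) \<longlonglongrightarrow> 0" for n
    using reflected_walk_mean_sublinear[OF W_indep W_sq _ _ s1,
        of "expectation (\<lambda>\<omega>. (w (X \<omega>))\<^sup>2)"] W_exp W_sq_exp drift_nonpos
    by (auto simp: S_def)
  have sum_W: "integrable M (\<lambda>\<omega>. \<Sum>i=1..n. W i \<omega>)"
    "expectation (\<lambda>\<omega>. \<Sum>i=1..n. W i \<omega>) = n * (\<alpha>c * m - m / \<alpha>d)" for n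
    using W_int W_exp by (auto simp: Bochner_Integration.integral_sum)
  let ?J = "average_cost M \<alpha>c \<alpha>d \<Delta> s1"

  have lower: "ennreal ((1 - \<alpha>) * m) \<le> ?J \<pi>" if adm: "admissible M \<alpha>c \<alpha>d \<Delta> s1 \<pi>" for \<pi>
  proof -
    let ?G = "\<lambda>n \<omega>. 1 / real n * (\<Sum>i=1..n. generation \<alpha>c \<alpha>d \<pi> s1 (\<lambda>j. \<Delta> j \<omega>) i)"
    \<comment> \<open>At \<open>n = 0\<close> division by zero makes the right side 0 and leaves
      \<open>(1 - \<alpha>) * m\<close> on the left, so the claim needs \<open>n > 0\<close>; the
      limit superior only sees large \<open>n\<close>.\<close>
    have "ennreal ((1 - \<alpha>) * m - \<alpha>d * s1 / n) \<le> (\<integral>\<^sup>+\<omega>. ennreal (?G n \<omega>) \<partial>M)" if "n > 0" for n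
    proof -
      let ?f = "\<lambda>\<omega>. 1 / real n * (\<alpha>d * (- s1 - (\<Sum>i=1..n. W i \<omega>)))"
      have "expectation ?f = 1 / n * (\<alpha>d * (- s1 - n * (\<alpha>c * m - m / \<alpha>d)))"
        using sum_W by (simp add: prob_space)
      also have "\<dots> = - (\<alpha>d * (\<alpha>c * m - m / \<alpha>d)) - \<alpha>d * s1 / n"
        using that by (simp add: field_simps)
      finally have "(1 - \<alpha>) * m - \<alpha>d * s1 / n = expectation ?f"
        unfolding drift by simp
      \<comment> \<open>\<open>?f\<close> can be negative, whereas \<open>ennreal\<close> cuts off
        at 0. Passing to the positive part only raises the expectation and makes it a nonnegative
        integral.\<close>
      also have "\<dots> \<le> expectation (\<lambda>\<omega>. max (?f \<omega>) 0)"
        using sum_W by (intro integral_mono) auto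
      finally have "ennreal ((1 - \<alpha>) * m - \<alpha>d * s1 / n)
          \<le> ennreal (expectation (\<lambda>\<omega>. max (?f \<omega>) 0))"
        by (rule ennreal_leI)
      also have "\<dots> = (\<integral>\<^sup>+\<omega>. ennreal (max (?f \<omega>) 0) \<partial>M)"
        using sum_W by (intro nn_integral_eq_integral[symmetric]) auto
      also have "\<dots> \<le> (\<integral>\<^sup>+\<omega>. ennreal (?G n \<omega>) \<partial>M)"
      proof (rule nn_integral_mono)
        fix \<omega> assume "\<omega> \<in> space M"
        then have "?f \<omega> \<le> ?G n \<omega>"
          using generation_sum_lower_bound[OF par adm, of \<omega> n]
          by (intro mult_left_mono) (auto simp: W_def w_def)
        then have "ennreal (?f \<omega>) \<le> ennreal (?G n \<omega>)" by (rule ennreal_leI)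
        then show "ennreal (max (?f \<omega>) 0) \<le> ennreal (?G n \<omega>)"
          by (simp add: max_def ennreal_neg split: if_splits)
      qed
      finally show ?thesis .
    qed
    then have "limsup (\<lambda>n. ennreal ((1 - \<alpha>) * m - \<alpha>d * s1 / n)) \<le> ?J \<pi>"
      unfolding average_cost_def
      by (intro Limsup_mono) (auto intro: eventually_mono[OF eventually_gt_at_top[of 0]])
    moreover have "(\<lambda>n. (1 - \<alpha>) * m - \<alpha>d * s1 / real n) \<longlonglongrightarrow> (1 - \<alpha>) * m"
      by real_asymp
    then have "limsup (\<lambda>n. ennreal ((1 - \<alpha>) * m - \<alpha>d * s1 / n)) = ennreal ((1 - \<alpha>) * m)"
      by (intro lim_imp_Limsup tendsto_ennrealI) auto
    ultimately show ?thesis by simp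
  qed

  have adm1: "admissible M \<alpha>c \<alpha>d \<Delta> s1 (policy1 \<alpha>d)"
    using policy1_admissible par s1 by blast
  have attained: "?J (policy1 \<alpha>d) = ennreal ((1 - \<alpha>) * m)"
  proof -
    let ?G = "\<lambda>n \<omega>. 1 / real n *
      (\<Sum>i=1..n. generation \<alpha>c \<alpha>d (policy1 \<alpha>d) s1 (\<lambda>j. \<Delta> j \<omega>) i)"
    let ?f = "\<lambda>n. (1 - \<alpha>) * m - \<alpha>d * s1 / real n + \<alpha>d * (expectation (S n) / n)"
    have eq: "(\<integral>\<^sup>+\<omega>. ennreal (?G n \<omega>) \<partial>M) = ennreal (?f n)" if "n > 0" for n
    proof -
      have G: "?G n = (\<lambda>\<omega>. 1 / real n * (\<alpha>d * (S n \<omega> - s1 - (\<Sum>i=1..n. W i \<omega>))))"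
        using generation_policy1_sum[OF par(1,3) s1] by (simp add: S_def W_def w_def)
      \<comment> \<open>Nonnegativity together with integrability turns the extended integral into
        an ordinary expectation, where linearity applies.\<close>
      have G_nonneg: "AE \<omega> in M. 0 \<le> ?G n \<omega>"
      proof (rule AE_I2)
        fix \<omega> assume "\<omega> \<in> space M"
        then show "0 \<le> ?G n \<omega>"
          using admissible_generation_nonneg[OF adm1]
          by (intro mult_nonneg_nonneg sum_nonneg) auto
      qed
      have G_int: "integrable M (?G n)"
        unfolding G using S sum_W by auto
      have "(\<integral>\<^sup>+\<omega>. ennreal (?G n \<omega>) \<partial>M) = ennreal (expectation (?G n))"
        by (rule nn_integral_eq_integral[OF G_int G_nonneg])
      also have "expectation (?G n)
          = 1 / n * (\<alpha>d * (expectation (S n) - s1 - n * (\<alpha>c * m - m / \<alpha>d)))"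
        unfolding G using S(1) sum_W by (simp add: prob_space)
      also have "\<dots> = - (\<alpha>d * (\<alpha>c * m - m / \<alpha>d)) - \<alpha>d * s1 / n + \<alpha>d * (expectation (S n) / n)"
        using that by (simp add: field_simps)
      finally show ?thesis unfolding drift by simp
    qed
    have "(\<lambda>n. (1 - \<alpha>) * m - \<alpha>d * s1 / real n) \<longlonglongrightarrow> (1 - \<alpha>) * m"
      by real_asymp
    from tendsto_add[OF this tendsto_mult_right_zero[OF S(2), of \<alpha>d]]
    have "?f \<longlonglongrightarrow> (1 - \<alpha>) * m" by simp
    then have "(\<lambda>n. ennreal (?f n)) \<longlonglongrightarrow> ennreal ((1 - \<alpha>) * m)"
      by (rule tendsto_ennrealI)
    then have "(\<lambda>n. \<integral>\<^sup>+\<omega>. ennreal (?G n \<omega>) \<partial>M) \<longlonglongrightarrow> ennreal ((1 - \<alpha>) * m)"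
      by (rule Lim_transform_eventually)
        (rule eventually_mono[OF eventually_gt_at_top[of 0]], rule eq[symmetric])
    then show ?thesis
      unfolding average_cost_def by (intro lim_imp_Limsup) auto
  qed
  \<comment> \<open>\<open>is_arg_min\<close> excludes admissible policies of strictly smaller cost;
    \<open>lower\<close> does so once \<open>attained\<close> identifies the cost of
    \<open>policy1\<close>.\<close>
  show ?thesis
    using lower adm1 attained by (auto simp: is_arg_min_def m_def not_less)
qed

end
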